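(* Let $\mathcal{A}=(A,\to_\mathcal{A})$ be an abstract reduction system and $P\Rightarrow Q$ an APR predicate over $A$. Then: (1) if $\{t\in A\mid \exists s\in P.\ s\to_\mathcal{A}^* t\}$ is finite, then there exists either an APR proof or an APR disproof for $P\Rightarrow Q$ w.r.t. $\mathcal{A}$; and (2) if $\{t\in A\mid \exists s\in P.\ s\to_\mathcal{A}^* t\}$ is finite and the emptiness, intersection-emptiness, and $\mathcal{A}$-runnability problems for $A$ are decidable, then partial validity of $P\Rightarrow Q$ w.r.t. $\mathcal{A}$ is decidable.
   Context: An abstract reduction system (ARS) is a pair $\mathcal{A}=(A,\to_\mathcal{A})$ of a set $A$ and a binary relation on $A$; $\to_\mathcal{A}^*$ is its reflexive-transitive closure. $\mathrm{NF}_\mathcal{A}$ is the set of normal forms. $\Delta_\mathcal{A}(P)=\{t\mid\exists s\in P.\ s\to_\mathcal{A}t\}$. $P$ is $\mathcal{A}$-runnable if $P\neq\emptyset$ and $P\cap\mathrm{NF}_\mathcal{A}=\emptyset$. The emptiness, intersection-emptiness and $\mathcal{A}$-runnability problems ask, for given subsets of $A$, whether a set is empty, whether the intersection of two sets is empty, and whether a set is $\mathcal{A}$-runnable. An APR predicate is a pair $P\Rightarrow Q$ with $P,Q\subseteq A$. $P\Rightarrow Q$ is partially valid w.r.t. $\mathcal{A}$ if it lies in the greatest fixed point of the functional (mapping a set $X$ of predicates to the conclusions of rule instances with all premises in $X$ and side conditions true) of the rules (Subsumption) no premises, conclude $P\Rightarrow Q$ if $P\subseteq Q$; (Step) from $\Delta_\mathcal{A}(P\setminus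 Q)\Rightarrow Q$ conclude $P\Rightarrow Q$ if $P\setminus Q$ is $\mathcal{A}$-runnable. Rules of $\mathrm{CDVP}'_\mathcal{A}$ (conclusion $P\Rightarrow Q$; $\bot$ denotes "invalid"): (Axiom) no premises, if $P=\emptyset$. (Subs) premises $P_i\Rightarrow Q$ ($1\le i\le n$), if $P\cap Q\neq\emptyset$, where $P\setminus Q=\bigcup_i P_i$, $n>0$, and if $n>1$ then $\emptyset\subsetneq P_i\subseteq P$. (Der) premises $P_i\Rightarrow Q$ ($1\le i\le n$), if $P\cap Q=\emptyset$ and $P$ is $\mathcal{A}$-runnable, where $\Delta_\mathcal{A}(P)=\bigcup_iP_i$, $n>0$, all $P_i\neq\emptyset$. (Dis) premise $\bot$, if $P\cap Q=\emptyset$, $P\ne\emptyset$, $P\cap\mathrm{NF}_\mathcal{A}\neq\emptyset$. An APR derivation tree is a finite tree $(V,a,r,p)$ with root $v_0$: $a$ labels each node with an APR predicate or $\bot$, $r$ partially assigns a rule of $\mathrm{CDVP}'_\mathcal{A}$, $p$ partially assigns the sequence of children, such that $p(v)$ is defined (as the list of $k$ children) exactly when $r(v)$ is a rule with $k$ premises and the children's labels over $a(v)$ form an instance of $r(v)$ ($p(v)=\varepsilon$ if $k=0$). A leaf ($p(v)=\varepsilon$ or undefined) is closed if $p(v)=\varepsilon$ or $a(v)=\bot$, else open; $V_{open}$ is the set of open leaves. An APR pre-proof for $P\Rightarrow Q$ is a pair $(\mathcal{T},\xi)$ with $a(v_0)=(P\Rightarrow Q)$ and $\xi$ a partial map $V_{open}\to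 V\setminus V_{open}$ with $a(v)=a(\xi(v))$ and $r(\xi(v))=\mathrm{Der}$ whenever defined. An APR proof is a pre-proof in which $\xi$ is defined on all of $V_{open}$. An APR disproof is a pre-proof containing a node $v$ with $r(v)=\mathrm{Dis}$.
   Formalization: In (2), subsets of A are given by codes, and difference of sets and one-step successors Δ are additionally assumed computable on codes; without this the decidability claim is false. Decidability is uniform in the codes of P and Q. *)

theory Defs
  imports Main
begin

section \<open>Abstract reduction systems\<close>

definition ars :: "'a set \<Rightarrow> 'a rel \<Rightarrow> bool" where
  "ars A R \<longleftrightarrow> R \<subseteq> A \<times> A"

definition normal_forms :: "'a set \<Rightarrow> 'a rel \<Rightarrow> 'a set" where
  "normal_forms A R = {t \<in> A. \<nexists>u. (t, u) \<in> R}"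

definition successors :: "'a rel \<Rightarrow> 'a set \<Rightarrow> 'a set" where
  "successors R P = {t. \<exists>s\<in>P. (s, t) \<in> R}"

definition reachable :: "'a set \<Rightarrow> 'a rel \<Rightarrow> 'a set \<Rightarrow> 'a set" where
  "reachable A R P = {t \<in> A. \<exists>s\<in>P. (s, t) \<in> R\<^sup>*}"

definition runnable :: "'a set \<Rightarrow> 'a rel \<Rightarrow> 'a set \<Rightarrow> bool" where
  "runnable A R P \<longleftrightarrow> P \<noteq> {} \<and> P \<inter> normal_forms A R = {}"

section \<open>All-path reachability predicates and partial validity\<close>

type_synonym 'a apr = "'a set \<times> 'a set"

definition apr_over :: "'a set \<Rightarrow> 'a apr set" where
  "apr_over A = {(P, Q). P \<subseteq> A \<and> Q \<subseteq> A}"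

inductive validity_rule :: "'a set \<Rightarrow> 'a rel \<Rightarrow> 'a apr list \<Rightarrow> 'a apr \<Rightarrow> bool"
  for A :: "'a set" and R :: "'a rel" where
  Subsumption: "(P, Q) \<in> apr_over A \<Longrightarrow> P \<subseteq> Q \<Longrightarrow> validity_rule A R [] (P, Q)"
| Step: "(P, Q) \<in> apr_over A \<Longrightarrow> runnable A R (P - Q) \<Longrightarrow>
    validity_rule A R [(successors R (P - Q), Q)] (P, Q)"

definition validity_functional :: "'a set \<Rightarrow> 'a rel \<Rightarrow> 'a apr set \<Rightarrow> 'a apr set" where
  "validity_functional A R X = {c. \<exists>ps. validity_rule A R ps c \<and> set ps \<subseteq> X}"

lemma mono_validity_functional: "mono (validity_functional A R)"
  unfolding mono_def validity_functional_def by blast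

definition partially_valid :: "'a set \<Rightarrow> 'a rel \<Rightarrow> 'a apr \<Rightarrow> bool" where
  "partially_valid A R c \<longleftrightarrow> c \<in> gfp (validity_functional A R)"

section \<open>The cyclic proof system\<close>

text \<open>\<open>Invalid\<close> is the label written as bottom.\<close>

datatype 'a apr_label = Pred "'a apr" | Invalid

datatype cdvp_rule = Axiom | Subs | Der | Dis

inductive cdvp_instance ::
  "'a set \<Rightarrow> 'a rel \<Rightarrow> cdvp_rule \<Rightarrow> 'a apr_label list \<Rightarrow> 'a apr_label \<Rightarrow> bool"
  for A :: "'a set" and R :: "'a rel" where
  Axiom: "P = {} \<Longrightarrow> cdvp_instance A R Axiom [] (Pred (P, Q))"
| Subs: "P \<inter> Q \<noteq> {} \<Longrightarrow> P - Q = \<Union> (set Ps) \<Longrightarrow> length Ps > 0 \<Longrightarrow>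
    (length Ps > 1 \<longrightarrow> (\<forall>P'\<in>set Ps. {} \<subset> P' \<and> P' \<subseteq> P)) \<Longrightarrow>
    cdvp_instance A R Subs (map (\<lambda>P'. Pred (P', Q)) Ps) (Pred (P, Q))"
| Der: "P \<inter> Q = {} \<Longrightarrow> runnable A R P \<Longrightarrow> successors R P = \<Union> (set Ps) \<Longrightarrow>
    length Ps > 0 \<Longrightarrow> (\<forall>P'\<in>set Ps. P' \<noteq> {}) \<Longrightarrow>
    cdvp_instance A R Der (map (\<lambda>P'. Pred (P', Q)) Ps) (Pred (P, Q))"
| Dis: "P \<inter> Q = {} \<Longrightarrow> P \<noteq> {} \<Longrightarrow> P \<inter> normal_forms A R \<noteq> {} \<Longrightarrow>
    cdvp_instance A R Dis [Invalid] (Pred (P, Q))"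

record ('v, 'a) apr_tree =
  nodes :: "'v set"
  root :: 'v
  label :: "'v \<Rightarrow> 'a apr_label"
  rule_at :: "'v \<rightharpoonup> cdvp_rule"
  children :: "'v \<rightharpoonup> 'v list"

definition child_rel :: "('v, 'a) apr_tree \<Rightarrow> 'v rel" where
  "child_rel T = {(v, w). v \<in> nodes T \<and> (\<exists>ws. children T v = Some ws \<and> w \<in> set ws)}"

definition finite_rooted_tree :: "('v, 'a) apr_tree \<Rightarrow> bool" where
  "finite_rooted_tree T \<longleftrightarrow>
     finite (nodes T) \<and> root T \<in> nodes T \<and>
     child_rel T \<subseteq> nodes T \<times> nodes T \<and>
     (\<forall>v\<in>nodes T. \<forall>ws. children T v = Some ws \<longrightarrow> distinct ws) \<and>
     (\<forall>v. (v, root T) \<notin> child_rel T) \<and>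
     (\<forall>u v w. (u, w) \<in> child_rel T \<longrightarrow> (v, w) \<in> child_rel T \<longrightarrow> u = v) \<and>
     (\<forall>v\<in>nodes T. (root T, v) \<in> (child_rel T)\<^sup>*)"

text \<open>A node carries a rule exactly if it has a list of children, and then the two form an
  instance of the rule. In particular a node cannot be marked \<open>Dis\<close> unless \<open>Dis\<close> has
  actually been applied there.\<close>

definition apr_derivation_tree :: "'a set \<Rightarrow> 'a rel \<Rightarrow> ('v, 'a) apr_tree \<Rightarrow> bool" where
  "apr_derivation_tree A R T \<longleftrightarrow>
     finite_rooted_tree T \<and>
     (\<forall>v\<in>nodes T. label T v \<in> insert Invalid (Pred ` apr_over A)) \<and>
     (\<forall>v\<in>nodes T. children T v = None \<longleftrightarrow> rule_at T v = None) \<and>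
     (\<forall>v\<in>nodes T. \<forall>\<rho> ws. rule_at T v = Some \<rho> \<longrightarrow> children T v = Some ws \<longrightarrow>
        cdvp_instance A R \<rho> (map (label T) ws) (label T v))"

definition leaves :: "('v, 'a) apr_tree \<Rightarrow> 'v set" where
  "leaves T = {v \<in> nodes T. children T v = Some [] \<or> children T v = None}"

definition closed_leaves :: "('v, 'a) apr_tree \<Rightarrow> 'v set" where
  "closed_leaves T = {v \<in> leaves T. children T v = Some [] \<or> label T v = Invalid}"

definition open_leaves :: "('v, 'a) apr_tree \<Rightarrow> 'v set" where
  "open_leaves T = leaves T - closed_leaves T"

definition apr_preproof ::
  "'a set \<Rightarrow> 'a rel \<Rightarrow> 'a apr \<Rightarrow> ('v, 'a) apr_tree \<Rightarrow> ('v \<rightharpoonup> 'v) \<Rightarrow> bool" where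
  "apr_preproof A R c T \<xi> \<longleftrightarrow>
     apr_derivation_tree A R T \<and> label T (root T) = Pred c \<and>
     dom \<xi> \<subseteq> open_leaves T \<and> ran \<xi> \<subseteq> nodes T - open_leaves T \<and>
     (\<forall>v w. \<xi> v = Some w \<longrightarrow> label T v = label T w \<and> rule_at T w = Some Der)"

definition apr_proof ::
  "'a set \<Rightarrow> 'a rel \<Rightarrow> 'a apr \<Rightarrow> ('v, 'a) apr_tree \<Rightarrow> ('v \<rightharpoonup> 'v) \<Rightarrow> bool" where
  "apr_proof A R c T \<xi> \<longleftrightarrow> apr_preproof A R c T \<xi> \<and> dom \<xi> = open_leaves T"

definition apr_disproof ::
  "'a set \<Rightarrow> 'a rel \<Rightarrow> 'a apr \<Rightarrow> ('v, 'a) apr_tree \<Rightarrow> ('v \<rightharpoonup> 'v) \<Rightarrow> bool" where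
  "apr_disproof A R c T \<xi> \<longleftrightarrow>
     apr_preproof A R c T \<xi> \<and> (\<exists>v\<in>nodes T. rule_at T v = Some Dis)"

section \<open>Partial recursive functions and decidability\<close>

text \<open>Kleene's schemes. \<open>computes f xs y\<close> states that \<open>f\<close> halts on \<open>xs\<close> with result \<open>y\<close>.
  In \<open>Prim\<close> and \<open>Mu\<close> the recursion and search variable is the first argument.\<close>

datatype recf = Zero | Succ | Proj nat | Comp recf "recf list" | Prim recf recf | Mu recf

inductive computes :: "recf \<Rightarrow> nat list \<Rightarrow> nat \<Rightarrow> bool" where
  Zero: "computes Zero xs 0"
| Succ: "computes Succ [x] (Suc x)"
| Proj: "i < length xs \<Longrightarrow> computes (Proj i) xs (xs ! i)"
| Comp: "list_all2 (\<lambda>g y. computes g xs y) gs ys \<Longrightarrow> computes f ys z \<Longrightarrow>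
    computes (Comp f gs) xs z"
| Prim_0: "computes f xs y \<Longrightarrow> computes (Prim f g) (0 # xs) y"
| Prim_Suc: "computes (Prim f g) (n # xs) y \<Longrightarrow> computes g (n # y # xs) z \<Longrightarrow>
    computes (Prim f g) (Suc n # xs) z"
| Mu: "computes f (n # xs) 0 \<Longrightarrow> (\<forall>m<n. \<exists>y. computes f (m # xs) (Suc y)) \<Longrightarrow>
    computes (Mu f) xs n"

lemma computes_deterministic: "computes f xs y \<Longrightarrow> computes f xs z \<Longrightarrow> y = z"
proof (induction arbitrary: z rule: computes.induct)
  case (Zero xs)
  then show ?case by (cases rule: computes.cases) auto
next
  case (Succ x)
  then show ?case by (cases rule: computes.cases) auto
next
  case (Proj i xs)
  from Proj.prems show ?case by (cases rule: computes.cases) auto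
next
  case (Comp xs gs ys f z z')
  from Comp.prems obtain ys' where ys': "list_all2 (\<lambda>g y. computes g xs y) gs ys'"
    and z': "computes f ys' z'" by (cases rule: computes.cases) auto
  have "ys = ys'"
  proof (rule nth_equalityI)
    show len: "length ys = length ys'"
      using list_all2_lengthD[OF Comp.IH(1)] list_all2_lengthD[OF ys'] by simp
    show "ys ! i = ys' ! i" if i: "i < length ys" for i
    proof -
      have "computes (gs ! i) xs (ys' ! i)"
        using list_all2_nthD2[OF ys'] i len by simp
      with list_all2_nthD2[OF Comp.IH(1) i] show ?thesis by blast
    qed
  qed
  with Comp.IH(2) z' show ?case by blast
next
  case (Prim_0 f xs y g)
  from Prim_0.prems have "computes f xs z" by (cases rule: computes.cases) auto
  then show ?case by (rule Prim_0.IH)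
next
  case (Prim_Suc f g n xs y z z')
  from Prim_Suc.prems obtain y' where "computes (Prim f g) (n # xs) y'"
    and "computes g (n # y' # xs) z'" by (cases rule: computes.cases) auto
  with Prim_Suc.IH show ?case by blast
next
  case (Mu f n xs)
  from Mu.prems have n0: "computes f (z # xs) 0"
    and n1: "\<forall>m<z. \<exists>y. computes f (m # xs) (Suc y)" by (cases rule: computes.cases; auto)+
  have "\<not> z < n" using Mu.IH(2) n0 by blast
  moreover have "\<not> n < z" using Mu.IH(1) n1 by blast
  ultimately show ?case by simp
qed

text \<open>The set \<open>I\<close> is the set of admissible inputs; nothing is required of the procedure,
  not even termination, on other inputs.\<close>

definition decidable1 :: "nat set \<Rightarrow> (nat \<Rightarrow> bool) \<Rightarrow> bool" where
  "decidable1 I L \<longleftrightarrow> (\<exists>f. \<forall>c\<in>I. computes f [c] (if L c then 1 else 0))"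

definition decidable2 :: "(nat \<times> nat) set \<Rightarrow> (nat \<Rightarrow> nat \<Rightarrow> bool) \<Rightarrow> bool" where
  "decidable2 I L \<longleftrightarrow> (\<exists>f. \<forall>(c, d)\<in>I. computes f [c, d] (if L c d then 1 else 0))"

text \<open>Decision problems about subsets of \<open>A\<close> need the subsets to be given by finite data: \<open>D\<close> is
  the set of codes, and \<open>\<nu> c\<close> is the subset denoted by the code \<open>c\<close>. The operations by which
  the rules form new predicates, difference and one-step successors, have to be computable on
  codes; decidability of the three problems alone does not give this.\<close>

definition effective_representation ::
  "'a set \<Rightarrow> 'a rel \<Rightarrow> nat set \<Rightarrow> (nat \<Rightarrow> 'a set) \<Rightarrow> bool" where
  "effective_representation A R D \<nu> \<longleftrightarrow>
     (\<forall>c\<in>D. \<nu> c \<subseteq> A) \<and>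
     (\<exists>f. \<forall>c\<in>D. \<forall>d\<in>D. \<exists>e\<in>D. computes f [c, d] e \<and> \<nu> e = \<nu> c - \<nu> d) \<and>
     (\<exists>f. \<forall>c\<in>D. \<exists>e\<in>D. computes f [c] e \<and> \<nu> e = successors R (\<nu> c))"

definition emptiness_decidable :: "nat set \<Rightarrow> (nat \<Rightarrow> 'a set) \<Rightarrow> bool" where
  "emptiness_decidable D \<nu> \<longleftrightarrow> decidable1 D (\<lambda>c. \<nu> c = {})"

definition intersection_emptiness_decidable :: "nat set \<Rightarrow> (nat \<Rightarrow> 'a set) \<Rightarrow> bool" where
  "intersection_emptiness_decidable D \<nu> \<longleftrightarrow> decidable2 (D \<times> D) (\<lambda>c d. \<nu> c \<inter> \<nu> d = {})"

definition runnability_decidable ::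
  "'a set \<Rightarrow> 'a rel \<Rightarrow> nat set \<Rightarrow> (nat \<Rightarrow> 'a set) \<Rightarrow> bool" where
  "runnability_decidable A R D \<nu> \<longleftrightarrow> decidable1 D (\<lambda>c. runnable A R (\<nu> c))"

end

theory Submission
  imports Defs
begin

text \<open>
  Partial validity of \<open>P \<Rightarrow> Q\<close> is a statement about the orbit of \<open>P\<close> under the
  deterministic step that maps \<open>P\<close> to the successors of \<open>P - Q\<close>. All sets in the orbit
  consist of terms reachable from \<open>P\<close>, so there are finitely many of them and the orbit is
  eventually periodic. Since the rules with several premises may always be used with a single
  one, a derivation can be taken to be a chain that follows the orbit: it ends with \<open>Axiom\<close>
  or \<open>Dis\<close>, or else some predicate occurs at two \<open>Der\<close> steps, and the second occurrence is
  linked to the first. For decidability, Floyd's search for \<open>n > 0\<close> with equal \<open>n\<close>-th and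
  \<open>2n\<close>-th iterates terminates, and the \<open>n\<close>-th iterate decides validity. Floyd's method only
  compares two sets at a time, so no coding of sequences is needed.
\<close>

section \<open>Orbits\<close>

text \<open>By the pigeonhole principle two iterates at indices \<open>i < j\<close> agree, so from
  \<open>i\<close> on the sequence has period \<open>j - i\<close>. An index \<open>m >= i\<close>
  that is a multiple of the period then agrees with \<open>2 * m\<close>.\<close>

lemma floyd_cycle_exists:
  fixes f :: "'a \<Rightarrow> 'a"
  assumes "finite S" "\<And>n. (f ^^ n) x \<in> S"
  shows "\<exists>n. (f ^^ Suc n) x = (f ^^ (2 * Suc n)) x"
proof -
  have "finite (range (\<lambda>n. (f ^^ n) x))"
    using assms by (meson finite_subset image_subsetI)
  then have "\<not> inj (\<lambda>n. (f ^^ n) x)"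
    using finite_imageD infinite_UNIV_nat by blast
  then obtain i j where ij: "i < j" "(f ^^ i) x = (f ^^ j) x"
    using linorder_injI[of "\<lambda>n. (f ^^ n) x"] by blast
  define p where "p = j - i"
  have period: "(f ^^ (m + p)) x = (f ^^ m) x" if "m \<ge> i" for m
  proof -
    have "(f ^^ (m + p)) x = (f ^^ ((m - i) + j)) x"
      using ij(1) that by (simp add: p_def)
    also have "\<dots> = (f ^^ ((m - i) + i)) x"
      by (simp only: funpow_add comp_apply ij(2))
    also have "\<dots> = (f ^^ m) x"
      using that by simp
    finally show ?thesis .
  qed
  have periods: "(f ^^ (m + k * p)) x = (f ^^ m) x" if "m \<ge> i" for m k
  proof (induction k)
    case (Suc k)
    then show ?case using period[of "m + k * p"] that by (simp add: algebra_simps)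
  qed simp
  \<comment> \<open>The factor \<open>Suc i\<close> makes this multiple of the period positive and
    at least \<open>i\<close>, so that \<open>periods\<close> applies to it.\<close>
  define m where "m = Suc i * p"
  obtain q where "p = Suc q" using ij(1) unfolding p_def by (meson gr0_implies_Suc zero_less_diff)
  then have "m > 0" "m \<ge> i" by (simp_all add: m_def)
  then obtain n where n: "m = Suc n" using gr0_implies_Suc by blast
  have "2 * m = m + Suc i * p" by (simp add: m_def)
  then have "(f ^^ (2 * m)) x = (f ^^ m) x" using periods[OF \<open>m \<ge> i\<close>] by presburger
  then show ?thesis unfolding n by (blast intro: sym)
qed

lemma successors_subset_reachable:
  assumes "ars A R" "P' \<subseteq> reachable A R P"
  shows "successors R P' \<subseteq> reachable A R P"
  using assms unfolding successors_def reachable_def ars_def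
  by (blast intro: rtrancl_into_rtrancl)

lemma subset_reachable: "P \<subseteq> A \<Longrightarrow> P \<subseteq> reachable A R P"
  unfolding reachable_def by auto

text \<open>Supplies the nonempty premise that \<open>Der\<close> demands. As
  \<open>normal_forms\<close> only collects elements of \<open>A\<close>, the inclusion in
  \<open>A\<close> is what gives each element a successor.\<close>

lemma successors_nonempty: "runnable A R P \<Longrightarrow> P \<subseteq> A \<Longrightarrow> successors R P \<noteq> {}"
  unfolding successors_def runnable_def normal_forms_def by blast

section \<open>Linear derivations\<close>

text \<open>A path through the nodes \<open>0\<close> to \<open>n\<close>. With
  \<open>last_rule = None\<close> the end has no rule: it is an open leaf, or a closed one if
  labelled \<open>Invalid\<close>. Otherwise it carries a rule without premises.\<close>

definition chain_tree ::
  "nat \<Rightarrow> (nat \<Rightarrow> 'a apr_label) \<Rightarrow> (nat \<Rightarrow> cdvp_rule) \<Rightarrow> cdvp_rule option \<Rightarrow> (nat, 'a) apr_tree" where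
  "chain_tree n l r last_rule =
     \<lparr>nodes = {..n}, root = 0, label = l,
      rule_at = (\<lambda>i. if i < n then Some (r i) else last_rule),
      children = (\<lambda>i. if i < n then Some [Suc i] else map_option (\<lambda>_. []) last_rule)\<rparr>"

lemma child_rel_chain_tree: "child_rel (chain_tree n l r q) = {(i, Suc i) | i. i < n}"
  by (auto simp: child_rel_def chain_tree_def split: if_splits)

lemma finite_rooted_chain_tree: "finite_rooted_tree (chain_tree n l r q)"
proof -
  have "(0, v) \<in> {(i, Suc i) | i. i < n}\<^sup>*" if "v \<le> n" for v
    using that by (induction v) (auto intro: rtrancl_into_rtrancl)
  then show ?thesis
    unfolding finite_rooted_tree_def child_rel_chain_tree
    by (auto simp: chain_tree_def split: if_splits)
qed

lemma chain_tree_derivation: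
  assumes "\<And>i. i \<le> n \<Longrightarrow> l i \<in> insert Invalid (Pred ` apr_over A)"
    and "\<And>i. i < n \<Longrightarrow> cdvp_instance A R (r i) [l (Suc i)] (l i)"
    and "\<And>\<rho>. q = Some \<rho> \<Longrightarrow> cdvp_instance A R \<rho> [] (l n)"
  shows "apr_derivation_tree A R (chain_tree n l r q)"
  unfolding apr_derivation_tree_def
proof (intro conjI finite_rooted_chain_tree ballI allI impI)
  fix v \<rho> ws
  assume "v \<in> nodes (chain_tree n l r q)" "rule_at (chain_tree n l r q) v = Some \<rho>"
    "children (chain_tree n l r q) v = Some ws"
  then show "cdvp_instance A R \<rho> (map (label (chain_tree n l r q)) ws) (label (chain_tree n l r q) v)"
    using assms(2,3) by (cases "v = n") (auto simp: chain_tree_def)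
qed (use assms(1) in \<open>auto simp: chain_tree_def\<close>)

lemma open_leaves_chain_tree:
  "open_leaves (chain_tree n l r q) = (if q = None \<and> l n \<noteq> Invalid then {n} else {})"
  unfolding open_leaves_def closed_leaves_def leaves_def
  by (auto simp: chain_tree_def split: if_splits)

section \<open>The orbit followed by the proof rules\<close>

definition chain_step :: "'a set \<Rightarrow> 'a rel \<Rightarrow> 'a set \<Rightarrow> 'a set \<Rightarrow> 'a set" where
  "chain_step A R Q Z = (if Z \<inter> Q \<noteq> {} then Z - Q else successors R Z)"

definition chain_rule :: "'a set \<Rightarrow> 'a set \<Rightarrow> cdvp_rule" where
  "chain_rule Q Z = (if Z \<inter> Q \<noteq> {} then Subs else Der)"

text \<open>With one premise the extra condition of \<open>Subs\<close> is vacuous, so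
  \<open>Z - Q\<close> may be empty; for \<open>Der\<close> runnability excludes an empty
  premise.\<close>

lemma chain_step_instance:
  assumes "Z \<subseteq> A" "Z \<inter> Q \<noteq> {} \<or> runnable A R Z"
  shows "cdvp_instance A R (chain_rule Q Z) [Pred (chain_step A R Q Z, Q)] (Pred (Z, Q))"
proof (cases "Z \<inter> Q = {}")
  case True
  then show ?thesis
    using cdvp_instance.Der[of Z Q A R "[successors R Z]"] successors_nonempty[of A R Z] assms
    by (simp add: chain_rule_def chain_step_def)
next
  case False
  then show ?thesis
    using cdvp_instance.Subs[of Z Q "[Z - Q]" A R]
    by (simp add: chain_rule_def chain_step_def)
qed

lemma proof_or_disproof_exists:
  assumes ars: "ars A R" and PQ: "(P, Q) \<in> apr_over A" and fin: "finite (reachable A R P)"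
  shows "(\<exists>(T :: (nat, 'a) apr_tree) \<xi>. apr_proof A R (P, Q) T \<xi>) \<or>
         (\<exists>(T :: (nat, 'a) apr_tree) \<xi>. apr_disproof A R (P, Q) T \<xi>)"
proof -
  define Z where "Z i = (chain_step A R Q ^^ i) P" for i
  define l where "l i = Pred (Z i, Q)" for i
  define r where "r i = chain_rule Q (Z i)" for i
  \<comment> \<open>Neither \<open>Subs\<close> nor \<open>Der\<close> applies at a stuck index. The
    set there is empty, which calls for \<open>Axiom\<close>, or contains a normal form, which calls
    for \<open>Dis\<close>.\<close>
  define stuck where "stuck i \<longleftrightarrow> Z i \<inter> Q = {} \<and> \<not> runnable A R (Z i)" for i
  have Z0: "Z 0 = P" by (simp add: Z_def)
  have Z_Suc: "Z (Suc i) = chain_step A R Q (Z i)" for i by (simp add: Z_def)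
  have Z_reachable: "Z i \<subseteq> reachable A R P" for i
  proof (induction i)
    case 0
    then show ?case using PQ by (simp add: Z0 apr_over_def subset_reachable)
  next
    case (Suc i)
    then show ?case
      using successors_subset_reachable[OF ars Suc.IH] by (auto simp: Z_Suc chain_step_def)
  qed
  then have Z_A: "Z i \<subseteq> A" for i by (auto simp: reachable_def)
  have l_over: "l i \<in> insert Invalid (Pred ` apr_over A)" for i
    using Z_A PQ by (auto simp: l_def apr_over_def)
  have inst: "cdvp_instance A R (r i) [l (Suc i)] (l i)" if "\<not> stuck i" for i
    using chain_step_instance[OF Z_A] that unfolding l_def r_def Z_Suc stuck_def by blast
  show ?thesis
  proof (cases "\<exists>k. stuck k")
    case True
    define k where "k = (LEAST k. stuck k)"
    have k: "stuck k" using True unfolding k_def by (meson LeastI)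
    have before_k: "\<not> stuck i" if "i < k" for i using that not_less_Least unfolding k_def by blast
    show ?thesis
    proof (cases "Z k = {}")
      case True
      let ?T = "chain_tree k l r (Some Axiom)"
      have "apr_derivation_tree A R ?T"
        using inst before_k l_over True
        by (intro chain_tree_derivation) (auto simp: l_def intro: cdvp_instance.Axiom)
      then have "apr_proof A R (P, Q) ?T Map.empty"
        by (simp add: apr_proof_def apr_preproof_def open_leaves_chain_tree)
          (simp add: chain_tree_def l_def Z0)
      then show ?thesis by blast
    next
      case False
      \<comment> \<open>The path gets one more node, labelled \<open>Invalid\<close>, as the premise
        of \<open>Dis\<close> at node \<open>k\<close>.\<close>
      define l' where "l' = l(Suc k := Invalid)"
      define r' where "r' = r(k := Dis)"
      let ?T = "chain_tree (Suc k) l' r' None"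
      have "cdvp_instance A R Dis [Invalid] (l k)"
        using k False cdvp_instance.Dis[of "Z k" Q A R] by (auto simp: l_def stuck_def runnable_def)
      then have "apr_derivation_tree A R ?T"
        using inst before_k l_over
        by (intro chain_tree_derivation) (auto simp: l'_def r'_def less_Suc_eq)
      then have "apr_disproof A R (P, Q) ?T Map.empty"
        by (simp add: apr_disproof_def apr_preproof_def open_leaves_chain_tree)
          (auto simp: chain_tree_def l'_def r'_def l_def Z0 intro!: bexI[of _ k])
      then show ?thesis by blast
    qed
  next
    case False
    define ders where "ders = {i. r i = Der}"
    \<comment> \<open>A \<open>Subs\<close> step removes \<open>Q\<close>, so the set after it is
      disjoint from \<open>Q\<close>: of two consecutive indices at least one is a
      \<open>Der\<close> step.\<close>
    have "\<exists>n>m. n \<in> ders" for m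
    proof (cases "Suc m \<in> ders")
      case False
      then have "Suc (Suc m) \<in> ders"
        by (auto simp: ders_def r_def chain_rule_def Z_Suc chain_step_def split: if_splits)
      then show ?thesis by (intro exI[of _ "Suc (Suc m)"]) simp
    qed blast
    then have "infinite ders" unfolding finite_nat_set_iff_bounded_le by (metis leD)
    \<comment> \<open>Links may only point to \<open>Der\<close> nodes, so the repetition is sought
      among the indices in \<open>ders\<close>.\<close>
    moreover have "finite (Z ` ders)"
      by (rule finite_subset[of _ "Pow (reachable A R P)"]) (use Z_reachable fin in auto)
    ultimately have "\<not> inj_on Z ders" using finite_imageD by blast
    then obtain i j where ij: "i \<in> ders" "i < j" "Z i = Z j"
      using linorder_inj_onI'[of ders Z] by blast
    \<comment> \<open>The path is cut at \<open>j\<close>: this node gets no rule and becomes the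
      only open leaf, to be linked to its ancestor \<open>i\<close>.\<close>
    let ?T = "chain_tree j l r None"
    have "apr_derivation_tree A R ?T"
      using inst l_over False by (intro chain_tree_derivation) auto
    moreover have "open_leaves ?T = {j}"
      by (simp add: open_leaves_chain_tree l_def)
    ultimately have "apr_proof A R (P, Q) ?T [j \<mapsto> i]"
      using ij by (simp add: apr_proof_def apr_preproof_def)
        (simp add: chain_tree_def l_def Z0 ders_def)
    then show ?thesis by blast
  qed
qed

section \<open>Partial validity along the orbit\<close>

text \<open>If \<open>P - Q\<close> is not runnable, the orbit stays at \<open>P\<close>, so the obstacle cannot be
  passed over in the search for a cycle.\<close>

definition valid_step :: "'a set \<Rightarrow> 'a rel \<Rightarrow> 'a set \<Rightarrow> 'a set \<Rightarrow> 'a set" where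
  "valid_step A R P Q = (if runnable A R (P - Q) then successors R (P - Q) else P)"

definition progresses :: "'a set \<Rightarrow> 'a rel \<Rightarrow> 'a set \<Rightarrow> 'a set \<Rightarrow> bool" where
  "progresses A R P Q \<longleftrightarrow> P - Q = {} \<or> runnable A R (P - Q)"

lemma partially_valid_unfold:
  "partially_valid A R (P, Q) \<longleftrightarrow> (P, Q) \<in> apr_over A \<and>
     (P - Q = {} \<or> runnable A R (P - Q) \<and> partially_valid A R (successors R (P - Q), Q))"
  unfolding partially_valid_def
  by (subst gfp_unfold[OF mono_validity_functional])
    (auto simp: validity_functional_def validity_rule.simps)

text \<open>The invariant for following the orbit. If \<open>P - Q\<close> is empty it is not
  runnable, so the step stays at \<open>P\<close> and validity persists trivially.\<close>

lemma partially_valid_step: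
  assumes "partially_valid A R (P, Q)"
  shows "progresses A R P Q" "partially_valid A R (valid_step A R P Q, Q)"
  using assms partially_valid_unfold[of A R P Q]
  by (auto simp: progresses_def valid_step_def runnable_def)

lemma valid_step_funpow_subset:
  assumes "ars A R" "P \<subseteq> A"
  shows "((\<lambda>X. valid_step A R X Q) ^^ n) P \<subseteq> reachable A R P"
proof (induction n)
  case (Suc n)
  let ?Y = "((\<lambda>X. valid_step A R X Q) ^^ n) P"
  have "successors R (?Y - Q) \<subseteq> reachable A R P"
    using Suc.IH by (intro successors_subset_reachable[OF assms(1)]) blast
  then show ?case using Suc.IH by (simp add: valid_step_def)
qed (simp add: assms subset_reachable)

text \<open>Forwards, validity is passed along the orbit by induction. Backwards, coinduction
  applies: an orbit that always progresses is a post-fixed point of the functional.\<close>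

lemma partially_valid_iff_orbit:
  assumes ars: "ars A R" and PQ: "(P, Q) \<in> apr_over A"
  shows "partially_valid A R (P, Q) \<longleftrightarrow>
    (\<forall>n. progresses A R (((\<lambda>X. valid_step A R X Q) ^^ n) P) Q)" (is "?V \<longleftrightarrow> (\<forall>n. ?ok n)")
proof
  assume ?V
  then have "partially_valid A R (((\<lambda>X. valid_step A R X Q) ^^ n) P, Q)" for n
    by (induction n) (auto intro: partially_valid_step)
  then show "\<forall>n. ?ok n" by (blast intro: partially_valid_step)
next
  assume ok: "\<forall>n. ?ok n"
  let ?Y = "\<lambda>n. ((\<lambda>X. valid_step A R X Q) ^^ n) P"
  let ?X = "range (\<lambda>n. (?Y n, Q))"
  have "?X \<subseteq> validity_functional A R ?X"
  proof
    fix c assume "c \<in> ?X"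
    then obtain n where c: "c = (?Y n, Q)" by blast
    have over: "(?Y n, Q) \<in> apr_over A"
      using valid_step_funpow_subset[OF ars, where P = P and Q = Q and n = n] PQ by (auto simp: apr_over_def reachable_def)
    show "c \<in> validity_functional A R ?X"
    proof (cases "runnable A R (?Y n - Q)")
      case True
      then have "(successors R (?Y n - Q), Q) = (?Y (Suc n), Q)"
        by (simp add: valid_step_def)
      then have "(successors R (?Y n - Q), Q) \<in> ?X" by (metis rangeI)
      then show ?thesis
        using validity_rule.Step[OF over True]
        unfolding c validity_functional_def by fastforce
    next
      case False
      then have "?Y n \<subseteq> Q" using ok by (auto simp: progresses_def)
      then show ?thesis
        using validity_rule.Subsumption[OF over] unfolding c validity_functional_def by fastforce
    qed
  qed
  then have "?X \<subseteq> gfp (validity_functional A R)" by (rule gfp_upperbound)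
  moreover have "(P, Q) \<in> ?X" by (rule range_eqI[of _ _ 0]) simp
  ultimately show ?V unfolding partially_valid_def by blast
qed

text \<open>Failure to progress is absorbing. A point on a cycle is visited at arbitrarily late
  times, so it would coincide with any failing point of the orbit; testing it alone
  suffices.\<close>

lemma partially_valid_iff_cycle:
  assumes "ars A R" "(P, Q) \<in> apr_over A"
    and cycle: "((\<lambda>X. valid_step A R X Q) ^^ Suc n) P = ((\<lambda>X. valid_step A R X Q) ^^ (2 * Suc n)) P"
  shows "partially_valid A R (P, Q) \<longleftrightarrow>
    progresses A R (((\<lambda>X. valid_step A R X Q) ^^ Suc n) P) Q"
proof -
  let ?f = "\<lambda>X. valid_step A R X Q"
  have "progresses A R ((?f ^^ k) P) Q" if ok: "progresses A R ((?f ^^ Suc n) P) Q" for k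
  proof (rule ccontr)
    assume stuck: "\<not> progresses A R ((?f ^^ k) P) Q"
    have fixed: "(?f ^^ (m + k)) P = (?f ^^ k) P" for m
    proof (induction m)
      case (Suc m)
      then show ?case using stuck by (simp add: valid_step_def progresses_def)
    qed simp
    have "(?f ^^ Suc n) ((?f ^^ Suc n) P) = (?f ^^ Suc n) P"
      using cycle by (simp only: mult_2 funpow_add comp_apply)
    then have "((?f ^^ Suc n) ^^ k) ((?f ^^ Suc n) P) = (?f ^^ Suc n) P"
      by (induction k) (simp_all only: funpow.simps comp_apply id_apply)
    then have "(?f ^^ (Suc n * k + Suc n)) P = (?f ^^ Suc n) P"
      by (simp only: funpow_mult funpow_add comp_apply)
    \<comment> \<open>The cycle point is revisited at this index, which is not before
      \<open>k\<close>, where the orbit is already frozen at the failing set.\<close>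
    moreover have "Suc n * k + Suc n = (n * k + Suc n) + k" by simp
    ultimately show False using fixed[of "n * k + Suc n"] stuck ok by metis
  qed
  then show ?thesis using partially_valid_iff_orbit[OF assms(1,2)] by blast
qed

section \<open>Computability\<close>

lemma computes_Comp1:
  "computes g xs y \<Longrightarrow> computes f [y] z \<Longrightarrow> computes (Comp f [g]) xs z"
  by (rule computes.Comp[of _ _ "[y]"]) simp_all

lemma computes_Comp2:
  "computes g xs y \<Longrightarrow> computes g' xs y' \<Longrightarrow> computes f [y, y'] z \<Longrightarrow>
    computes (Comp f [g, g']) xs z"
  by (rule computes.Comp[of _ _ "[y, y']"]) simp_all

lemma computes_Comp3:
  "computes g xs y \<Longrightarrow> computes g' xs y' \<Longrightarrow> computes g'' xs y'' \<Longrightarrow>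
    computes f [y, y', y''] z \<Longrightarrow> computes (Comp f [g, g', g'']) xs z"
  by (rule computes.Comp[of _ _ "[y, y', y'']"]) simp_all

lemma computes_Proj: "i < length xs \<Longrightarrow> y = xs ! i \<Longrightarrow> computes (Proj i) xs y"
  by (simp add: computes.Proj)

text \<open>Primitive recursion on the test value: \<open>0\<close> returns \<open>b\<close>, and
  the successor step discards the previous value and returns \<open>a\<close>. Both branches are
  always evaluated, hence both must halt.\<close>

definition If_rec :: "recf \<Rightarrow> recf \<Rightarrow> recf \<Rightarrow> recf" where
  "If_rec t a b = Comp (Prim (Proj 1) (Proj 2)) [t, a, b]"

lemma computes_If_rec:
  assumes t: "computes t xs (if B then 1 else 0)" and a: "computes a xs u" and b: "computes b xs v"
  shows "computes (If_rec t a b) xs (if B then u else v)"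
proof -
  have base: "computes (Prim (Proj 1) (Proj 2)) [0, u, v] v"
    by (rule computes.Prim_0) (simp add: computes_Proj)
  then have "computes (Prim (Proj 1) (Proj 2)) [1, u, v] u"
    using computes.Prim_Suc[OF base] by (simp add: computes_Proj)
  with base have "computes (Prim (Proj 1) (Proj 2)) [if B then 1 else 0, u, v] (if B then u else v)"
    by simp
  then show ?thesis unfolding If_rec_def by (rule computes_Comp3[OF t a b])
qed

lemma computes_one: "computes (Comp Succ [Zero]) xs 1"
  using computes_Comp1[OF computes.Zero computes.Succ] by simp

section \<open>Set operations computed on codes\<close>

text \<open>Only the denoted set is prescribed, not the code: one set may have many codes, so codes
  cannot be compared as numbers.\<close>

definition realizes :: "nat set \<Rightarrow> (nat \<Rightarrow> 'a set) \<Rightarrow> recf \<Rightarrow> ('a set \<Rightarrow> 'a set \<Rightarrow> 'a set) \<Rightarrow> bool" where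
  "realizes D \<nu> f op \<longleftrightarrow>
     (\<forall>c\<in>D. \<forall>d\<in>D. \<exists>e\<in>D. computes f [c, d] e \<and> \<nu> e = op (\<nu> c) (\<nu> d))"

lemma realizesE:
  assumes "realizes D \<nu> f op" "c \<in> D" "d \<in> D"
  obtains e where "e \<in> D" "computes f [c, d] e" "\<nu> e = op (\<nu> c) (\<nu> d)"
  using assms unfolding realizes_def by blast

lemma realizes_funpow:
  assumes f: "realizes D \<nu> f op" and D: "c \<in> D" "d \<in> D"
  shows "\<exists>e\<in>D. computes (Prim (Proj 0) (Comp f [Proj 1, Proj 3])) [n, c, d] e \<and>
    \<nu> e = ((\<lambda>X. op X (\<nu> d)) ^^ n) (\<nu> c)"
proof (induction n)
  case 0
  have "computes (Prim (Proj 0) (Comp f [Proj 1, Proj 3])) [0, c, d] c"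
    by (rule computes.Prim_0) (simp add: computes_Proj)
  then show ?case using D by auto
next
  case (Suc n)
  then obtain e where e: "e \<in> D" "computes (Prim (Proj 0) (Comp f [Proj 1, Proj 3])) [n, c, d] e"
    "\<nu> e = ((\<lambda>X. op X (\<nu> d)) ^^ n) (\<nu> c)" by blast
  obtain e' where e': "e' \<in> D" "computes f [e, d] e'" "\<nu> e' = op (\<nu> e) (\<nu> d)"
    using realizesE[OF f e(1) D(2)] .
  \<comment> \<open>The recursion step receives the counter, the previous value and then the
    parameters, so \<open>Proj 1\<close> is the current code and \<open>Proj 3\<close> is
    \<open>d\<close>.\<close>
  have "computes (Comp f [Proj 1, Proj 3]) [n, e, c, d] e'"
    by (rule computes_Comp2[OF _ _ e'(2)]) (simp_all add: computes_Proj)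
  with e(2) have "computes (Prim (Proj 0) (Comp f [Proj 1, Proj 3])) [Suc n, c, d] e'"
    by (rule computes.Prim_Suc)
  then show ?case using e' e(3) by auto
qed

text \<open>The fast runner of Floyd's method: iterating the doubled step avoids computing
  \<open>2 * n\<close>.\<close>

lemma realizes_twice:
  assumes f: "realizes D \<nu> f op"
  shows "realizes D \<nu> (Comp f [f, Proj 1]) (\<lambda>X Y. op (op X Y) Y)"
  unfolding realizes_def
proof (intro ballI)
  fix c d assume D: "c \<in> D" "d \<in> D"
  obtain e where e: "e \<in> D" "computes f [c, d] e" "\<nu> e = op (\<nu> c) (\<nu> d)"
    using realizesE[OF f D] .
  obtain e' where e': "e' \<in> D" "computes f [e, d] e'" "\<nu> e' = op (\<nu> e) (\<nu> d)"
    using realizesE[OF f e(1) D(2)] .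
  have "computes (Comp f [f, Proj 1]) [c, d] e'"
    by (rule computes_Comp2[OF e(2) _ e'(2)]) (simp add: computes_Proj)
  then show "\<exists>e\<in>D. computes (Comp f [f, Proj 1]) [c, d] e \<and> \<nu> e = op (op (\<nu> c) (\<nu> d)) (\<nu> d)"
    using e e' by auto
qed

lemma funpow_double:
  fixes f :: "'a \<Rightarrow> 'a"
  shows "((\<lambda>x. f (f x)) ^^ n) x = (f ^^ (2 * n)) x"
  by (induction n) auto

lemma realizes_valid_step:
  assumes diff: "realizes D \<nu> diff (-)"
    and succ: "\<And>c. c \<in> D \<Longrightarrow> \<exists>e\<in>D. computes succ [c] e \<and> \<nu> e = successors R (\<nu> c)"
    and run: "\<And>c. c \<in> D \<Longrightarrow> computes run [c] (if runnable A R (\<nu> c) then 1 else 0)"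
  shows "realizes D \<nu> (If_rec (Comp run [diff]) (Comp succ [diff]) (Proj 0)) (valid_step A R)"
  unfolding realizes_def
proof (intro ballI)
  fix c d assume D: "c \<in> D" "d \<in> D"
  obtain x where x: "x \<in> D" "computes diff [c, d] x" "\<nu> x = \<nu> c - \<nu> d"
    using realizesE[OF diff D] .
  obtain y where y: "y \<in> D" "computes succ [x] y" "\<nu> y = successors R (\<nu> x)"
    using succ[OF x(1)] by blast
  let ?e = "if runnable A R (\<nu> x) then y else c"
  have "computes (If_rec (Comp run [diff]) (Comp succ [diff]) (Proj 0)) [c, d] ?e"
    using computes_Comp1[OF x(2) run[OF x(1)]] computes_Comp1[OF x(2) y(2)]
    by (rule computes_If_rec) (simp add: computes_Proj)
  moreover have "\<nu> ?e = valid_step A R (\<nu> c) (\<nu> d)" "?e \<in> D"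
    using x y D by (simp_all add: valid_step_def)
  ultimately show "\<exists>e\<in>D. computes (If_rec (Comp run [diff]) (Comp succ [diff]) (Proj 0)) [c, d] e \<and>
      \<nu> e = valid_step A R (\<nu> c) (\<nu> d)" by blast
qed

text \<open>Equality of the denoted sets, tested by emptiness of both differences. Equality yields
  \<open>0\<close> because \<open>Mu\<close> searches for a zero.\<close>

definition differ_rec :: "recf \<Rightarrow> recf \<Rightarrow> recf \<Rightarrow> recf \<Rightarrow> recf" where
  "differ_rec empt diff a b =
     If_rec (Comp empt [Comp diff [a, b]])
       (If_rec (Comp empt [Comp diff [b, a]]) Zero (Comp Succ [Zero]))
       (Comp Succ [Zero])"

lemma computes_differ_rec:
  assumes diff: "realizes D \<nu> diff (-)"
    and empt: "\<And>c. c \<in> D \<Longrightarrow> computes empt [c] (if \<nu> c = {} then 1 else 0)"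
    and a: "computes a xs c" "c \<in> D" and b: "computes b xs d" "d \<in> D"
  shows "computes (differ_rec empt diff a b) xs (if \<nu> c = \<nu> d then 0 else 1)"
proof -
  have test: "computes (Comp empt [Comp diff [g, h]]) xs (if \<nu> x - \<nu> y = {} then 1 else 0)"
    if gh: "computes g xs x" "computes h xs y" and D: "x \<in> D" "y \<in> D" for g h x y
  proof -
    obtain e where e: "e \<in> D" "computes diff [x, y] e" "\<nu> e = \<nu> x - \<nu> y"
      using realizesE[OF diff D] .
    show ?thesis
      using computes_Comp1[OF computes_Comp2[OF gh e(2)] empt[OF e(1)]] e(3) by simp
  qed
  have "computes (differ_rec empt diff a b) xs
      (if \<nu> c - \<nu> d = {} then if \<nu> d - \<nu> c = {} then 0 else 1 else 1)"
    unfolding differ_rec_def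
    by (intro computes_If_rec test a b computes_one computes.Zero)
  moreover have "(if \<nu> c - \<nu> d = {} then if \<nu> d - \<nu> c = {} then 0 else 1 else 1) =
      (if \<nu> c = \<nu> d then 0 else (1::nat))"
    by auto
  ultimately show ?thesis by simp
qed

section \<open>The decision procedure\<close>

text \<open>The program is fixed before the inputs are chosen; finiteness of the reachable set
  guarantees that the search for a cycle halts.\<close>

lemma partial_validity_decidable:
  fixes A :: "'a set"
  assumes ars: "ars A R" and rep: "effective_representation A R D \<nu>"
    and "emptiness_decidable D \<nu>" "runnability_decidable A R D \<nu>"
  shows "decidable2 {(c, d). c \<in> D \<and> d \<in> D \<and> finite (reachable A R (\<nu> c))}
    (\<lambda>c d. partially_valid A R (\<nu> c, \<nu> d))"
proof -
  obtain diff where diff: "realizes D \<nu> diff (-)"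
    using rep unfolding effective_representation_def realizes_def by blast
  obtain succ where succ: "\<And>c. c \<in> D \<Longrightarrow> \<exists>e\<in>D. computes succ [c] e \<and> \<nu> e = successors R (\<nu> c)"
    using rep unfolding effective_representation_def by blast
  obtain empt where empt: "\<And>c. c \<in> D \<Longrightarrow> computes empt [c] (if \<nu> c = {} then 1 else 0)"
    using assms(3) unfolding emptiness_decidable_def decidable1_def by blast
  obtain run where run: "\<And>c. c \<in> D \<Longrightarrow> computes run [c] (if runnable A R (\<nu> c) then 1 else 0)"
    using assms(4) unfolding runnability_decidable_def decidable1_def by blast
  obtain f where f: "realizes D \<nu> f (valid_step A R)"
    using realizes_valid_step[OF diff succ run] by blast
  \<comment> \<open>The counter is shifted by one, since at \<open>0\<close> both runners stand at
    the start and would agree trivially.\<close>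
  define iter where "iter g = Comp (Prim (Proj 0) (Comp g [Proj 1, Proj 3]))
    [Comp Succ [Proj 0], Proj 1, Proj 2]" for g
  have iter: "\<exists>e\<in>D. computes (iter g) [n, c, d] e \<and> \<nu> e = ((\<lambda>X. op X (\<nu> d)) ^^ Suc n) (\<nu> c)"
    if g: "realizes D \<nu> g op" and D: "c \<in> D" "d \<in> D" for g op n c d
  proof -
    obtain e where e: "e \<in> D" "\<nu> e = ((\<lambda>X. op X (\<nu> d)) ^^ Suc n) (\<nu> c)"
      "computes (Prim (Proj 0) (Comp g [Proj 1, Proj 3])) [Suc n, c, d] e"
      using realizes_funpow[OF g D] by blast
    have "computes (iter g) [n, c, d] e"
      unfolding iter_def
      by (rule computes_Comp3[OF computes_Comp1[OF _ computes.Succ] _ _ e(3)])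
        (simp_all add: computes_Proj)
    with e show ?thesis by blast
  qed
  define search where "search = Mu (differ_rec empt diff (iter f) (iter (Comp f [f, Proj 1])))"
  define rest where "rest = Comp diff [iter f, Proj 2]"
  \<comment> \<open>This tests \<open>progresses\<close> at the cycle point: the rest outside the
    target is runnable or else empty.\<close>
  define check where "check = If_rec (Comp run [rest]) (Comp Succ [Zero]) (Comp empt [rest])"
  have "computes (Comp check [search, Proj 0, Proj 1]) [c, d]
      (if partially_valid A R (\<nu> c, \<nu> d) then 1 else 0)"
    if D: "c \<in> D" "d \<in> D" and fin: "finite (reachable A R (\<nu> c))" for c d
  proof -
    have sub: "\<nu> c \<subseteq> A" "\<nu> d \<subseteq> A"
      using rep D unfolding effective_representation_def by blast+
    let ?Y = "\<lambda>n. ((\<lambda>X. valid_step A R X (\<nu> d)) ^^ n) (\<nu> c)"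
    let ?cycle = "\<lambda>n. ?Y (Suc n) = ?Y (2 * Suc n)"
    have differ: "computes (differ_rec empt diff (iter f) (iter (Comp f [f, Proj 1]))) [n, c, d]
        (if ?cycle n then 0 else 1)" for n
    proof -
      obtain x where x: "x \<in> D" "computes (iter f) [n, c, d] x" "\<nu> x = ?Y (Suc n)"
        using iter[OF f D] by blast
      obtain y where y: "y \<in> D" "computes (iter (Comp f [f, Proj 1])) [n, c, d] y"
        "\<nu> y = ?Y (2 * Suc n)"
        using iter[OF realizes_twice[OF f] D]
        unfolding funpow_double[where f = "\<lambda>X. valid_step A R X (\<nu> d)"] by blast
      show ?thesis
        using computes_differ_rec[OF diff empt x(2,1) y(2,1)] unfolding x(3) y(3) by simp
    qed
    \<comment> \<open>The least witness is taken because \<open>Mu\<close> requires a positive value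
      at every smaller argument.\<close>
    define n where "n = (LEAST n. ?cycle n)"
    have "\<exists>n. ?cycle n"
      by (rule floyd_cycle_exists[of "Pow (reachable A R (\<nu> c))"])
        (use fin valid_step_funpow_subset[OF ars sub(1)] in auto)
    then have n: "?cycle n" unfolding n_def by (rule LeastI_ex)
    have before_n: "\<not> ?cycle m" if "m < n" for m
      using that not_less_Least unfolding n_def by blast
    have search: "computes search [c, d] n"
      unfolding search_def
    proof (rule computes.Mu)
      show "computes (differ_rec empt diff (iter f) (iter (Comp f [f, Proj 1]))) [n, c, d] 0"
        using differ[of n] unfolding if_P[OF n] .
      show "\<forall>m<n. \<exists>y. computes (differ_rec empt diff (iter f) (iter (Comp f [f, Proj 1])))
          [m, c, d] (Suc y)"
      proof (intro allI impI exI)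
        fix m assume "m < n"
        show "computes (differ_rec empt diff (iter f) (iter (Comp f [f, Proj 1]))) [m, c, d] (Suc 0)"
          using differ[of m] unfolding if_not_P[OF before_n[OF \<open>m < n\<close>]] One_nat_def .
      qed
    qed
    obtain x where x: "x \<in> D" "computes (iter f) [n, c, d] x" "\<nu> x = ?Y (Suc n)"
      using iter[OF f D] by blast
    obtain e where e: "e \<in> D" "computes diff [x, d] e" "\<nu> e = \<nu> x - \<nu> d"
      using realizesE[OF diff x(1) D(2)] .
    have rest: "computes rest [n, c, d] e"
      unfolding rest_def by (rule computes_Comp2[OF x(2) _ e(2)]) (simp add: computes_Proj)
    have "computes check [n, c, d] (if runnable A R (\<nu> e) then 1 else if \<nu> e = {} then 1 else 0)"
      unfolding check_def
      by (intro computes_If_rec computes_one computes_Comp1[OF rest] run empt e(1))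
    moreover have "(if runnable A R (\<nu> e) then 1 else if \<nu> e = {} then 1 else 0) =
        (if partially_valid A R (\<nu> c, \<nu> d) then 1 else (0::nat))"
      using partially_valid_iff_cycle[OF ars _ n] sub
      unfolding e(3) x(3) progresses_def apr_over_def by auto
    ultimately have "computes check [n, c, d] (if partially_valid A R (\<nu> c, \<nu> d) then 1 else 0)"
      by simp
    then show ?thesis
      by (rule computes_Comp3[OF search, rotated 2]) (simp_all add: computes_Proj)
  qed
  then show ?thesis unfolding decidable2_def by blast
qed

theorem theorem21:
  fixes A :: "'a set" and R :: "'a rel"
  assumes "ars A R"
  shows "(\<forall>P Q. (P, Q) \<in> apr_over A \<longrightarrow> finite (reachable A R P) \<longrightarrow>
            (\<exists>(T :: (nat, 'a) apr_tree) \<xi>. apr_proof A R (P, Q) T \<xi>) \<or>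
            (\<exists>(T :: (nat, 'a) apr_tree) \<xi>. apr_disproof A R (P, Q) T \<xi>)) \<and>
         (\<forall>D (\<nu> :: nat \<Rightarrow> 'a set). effective_representation A R D \<nu> \<longrightarrow>
            emptiness_decidable D \<nu> \<longrightarrow>
            intersection_emptiness_decidable D \<nu> \<longrightarrow>
            runnability_decidable A R D \<nu> \<longrightarrow>
            decidable2 {(c, d). c \<in> D \<and> d \<in> D \<and> finite (reachable A R (\<nu> c))}
              (\<lambda>c d. partially_valid A R (\<nu> c, \<nu> d)))"
  using proof_or_disproof_exists[OF assms] partial_validity_decidable[OF assms] by blast

end
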